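(* Let $w=\{w_n\}_{n\in\mathbb{Z}}$ be a bounded sequence of non-zero complex numbers for which there exists $j\in\mathbb{N}$ such that $$\liminf_{m\to+\infty}\frac{\widetilde w(a-jm,0)}{(\widetilde w(1,m))^j}=0\quad\text{for each } a\in\mathbb{N}.$$ Then the weighted bilateral shift $T_{w,p}$ is cyclic for every $p$ with $1\leq p\leq\infty$.
   Context: All vector spaces are over $\mathbb{C}$; $\mathbb{Z}_+$ is the set of non-negative integers, $\mathbb{N}$ the set of positive integers. For integers $a\leq b$, $\widetilde w(a,b)=\prod_{j=a}^{b}|w_j|$. For a bounded sequence $w$ of non-zero complex numbers, the weighted bilateral shift $T_{w,p}$ is the bounded linear operator acting on $\ell_p(\mathbb{Z})$ if $1\leq p<\infty$, and on $c_0(\mathbb{Z})$ if $p=\infty$, defined on the canonical basis by $T_{w,p}e_n=w_ne_{n-1}$ for $n\in\mathbb{Z}$. A bounded linear operator $T$ on a Banach space $\mathcal{B}$ is cyclic if there is $x\in\mathcal{B}$ such that the linear span of $\{T^nx:n\in\mathbb{Z}_+\}$ is dense in $\mathcal{B}$. *)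

theory Defs
  imports "HOL-Analysis.Analysis" "HOL-Library.Function_Algebras"
begin

section \<open>Complex sequences indexed by the integers\<close>

definition cscale :: "complex \<Rightarrow> ('a \<Rightarrow> complex) \<Rightarrow> 'a \<Rightarrow> complex" where
  "cscale c x = (\<lambda>n. c * x n)"

lemma vector_space_cscale: "vector_space cscale"
  by unfold_locales (auto simp: cscale_def algebra_simps)

lemma module_cscale: "module cscale"
  using vector_space_cscale by (simp add: module_iff_vector_space)

text \<open>
  The space is the sequence space of exponent \<open>p\<close> when \<open>1 \<le> p < \<infinity>\<close>. At \<open>p = \<infinity>\<close> it is the space
  \<open>c\<^sub>0\<close> with the supremum norm, not the space of all bounded sequences.
\<close>

definition lp_space :: "ereal \<Rightarrow> (int \<Rightarrow> complex) set" where
  "lp_space p =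
     (if p = \<infinity> then {x. (x \<longlongrightarrow> 0) cofinite}
      else {x. (\<lambda>n. norm (x n) powr real_of_ereal p) summable_on UNIV})"

definition lp_norm :: "ereal \<Rightarrow> (int \<Rightarrow> complex) \<Rightarrow> real" where
  "lp_norm p x =
     (if p = \<infinity> then (SUP n. norm (x n))
      else (\<Sum>\<^sub>\<infinity>n. norm (x n) powr real_of_ereal p) powr (1 / real_of_ereal p))"

definition basis_vec :: "int \<Rightarrow> int \<Rightarrow> complex" where
  "basis_vec n = (\<lambda>k. if k = n then 1 else 0)"

section \<open>Operators and cyclicity\<close>

text \<open>
  A normed space is given by a carrier \<open>B\<close> and a norm \<open>N\<close> on it, because the exponent \<open>p\<close> is a
  variable of the theorem and cannot be part of a type.
\<close>

definition bounded_operator ::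
    "('a \<Rightarrow> complex) set \<Rightarrow> (('a \<Rightarrow> complex) \<Rightarrow> real)
      \<Rightarrow> (('a \<Rightarrow> complex) \<Rightarrow> ('a \<Rightarrow> complex)) \<Rightarrow> bool" where
  "bounded_operator B N T \<longleftrightarrow>
     (\<forall>x\<in>B. T x \<in> B) \<and>
     (\<forall>x\<in>B. \<forall>y\<in>B. T (x + y) = T x + T y) \<and>
     (\<forall>c. \<forall>x\<in>B. T (cscale c x) = cscale c (T x)) \<and>
     (\<exists>C. \<forall>x\<in>B. N (T x) \<le> C * N x)"

definition cyclic_operator ::
    "('a \<Rightarrow> complex) set \<Rightarrow> (('a \<Rightarrow> complex) \<Rightarrow> real)
      \<Rightarrow> (('a \<Rightarrow> complex) \<Rightarrow> ('a \<Rightarrow> complex)) \<Rightarrow> bool" where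
  "cyclic_operator B N T \<longleftrightarrow>
     (\<exists>x\<in>B. \<forall>y\<in>B. \<forall>e>0. \<exists>z \<in> module.span cscale (range (\<lambda>n. (T ^^ n) x)). N (y - z) < e)"

section \<open>The weighted bilateral shift\<close>

text \<open>
  The shift sends \<open>basis_vec n\<close> to \<open>w n\<close> times \<open>basis_vec (n - 1)\<close>. In coordinates this reads as
  below; the lemmas \<open>bilateral_shift_basis_vec\<close>, \<open>bounded_operator_bilateral_shift\<close> and
  \<open>bilateral_shift_unique\<close> show that it is the unique bounded operator with this action on the basis.
\<close>

definition bilateral_shift :: "(int \<Rightarrow> complex) \<Rightarrow> (int \<Rightarrow> complex) \<Rightarrow> (int \<Rightarrow> complex)" where
  "bilateral_shift w x = (\<lambda>n. w (n + 1) * x (n + 1))"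

definition wtilde :: "(int \<Rightarrow> complex) \<Rightarrow> int \<Rightarrow> int \<Rightarrow> real" where
  "wtilde w a b = (\<Prod>j\<in>{a..b}. norm (w j))"

lemma bilateral_shift_basis_vec:
  "bilateral_shift w (basis_vec n) = cscale (w n) (basis_vec (n - 1))"
  by (auto simp: bilateral_shift_def basis_vec_def cscale_def fun_eq_iff)

lemma ereal_ge_1_cases:
  assumes "1 \<le> (p::ereal)"
  obtains "p = \<infinity>" | r where "p = ereal r" "r \<ge> 1"
  using assms by (cases p) auto

lemma shift_int_bij: "bij (\<lambda>n::int. n + 1)"
  by (rule bij_betwI[where g = "\<lambda>n. n - 1"]) auto

lemma c0_bounded:
  assumes "(x \<longlongrightarrow> 0) cofinite"
  shows "bounded (range (x :: int \<Rightarrow> complex))"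
proof -
  have fin: "finite {n. \<not> norm (x n) < 1}"
    using tendstoD[OF assms, of 1] by (simp add: eventually_cofinite dist_norm)
  have "range x \<subseteq> cball 0 1 \<union> x ` {n. \<not> norm (x n) < 1}"
    by (auto simp: image_iff)
  moreover have "bounded (cball 0 1 \<union> x ` {n. \<not> norm (x n) < 1})"
    using fin by (simp add: finite_imp_bounded)
  ultimately show ?thesis by (rule bounded_subset[rotated])
qed

lemma c0_bdd_above:
  assumes "(x \<longlongrightarrow> 0) cofinite"
  shows "bdd_above (range (\<lambda>n::int. norm (x n :: complex)))"
  using c0_bounded[OF assms] by (auto simp: bounded_iff bdd_above_def)

lemma coord_le_lp_norm:
  assumes p: "1 \<le> p" and x: "x \<in> lp_space p"
  shows "norm (x n) \<le> lp_norm p x"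
  using p
proof (cases rule: ereal_ge_1_cases)
  case 1
  then show ?thesis using x c0_bdd_above[of x]
    by (auto simp: lp_space_def lp_norm_def intro!: cSUP_upper)
next
  case (2 r)
  have "norm (x n) powr r \<le> (\<Sum>\<^sub>\<infinity>n. norm (x n) powr r)"
    using finite_sum_le_infsum[of "\<lambda>n. norm (x n) powr r" UNIV "{n}"] x 2
    by (auto simp: lp_space_def)
  then have "(norm (x n) powr r) powr (1/r) \<le> (\<Sum>\<^sub>\<infinity>n. norm (x n) powr r) powr (1/r)"
    using 2 by (intro powr_mono2) auto
  then show ?thesis using 2 by (simp add: lp_norm_def powr_powr)
qed

lemma lp_space_dominated:
  assumes p: "1 \<le> p" and x: "x \<in> lp_space p" and le: "\<And>n. norm (y n) \<le> norm (x n)"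
  shows "y \<in> lp_space p"
  using p
proof (cases rule: ereal_ge_1_cases)
  case 1
  then have "((\<lambda>n. norm (x n)) \<longlongrightarrow> 0) cofinite"
    using x by (simp add: lp_space_def tendsto_norm_zero)
  then have "(y \<longlongrightarrow> 0) cofinite"
    by (rule Lim_null_comparison[rotated]) (simp add: le)
  then show ?thesis using 1 by (simp add: lp_space_def)
next
  case (2 r)
  have "(\<lambda>n. norm (y n) powr r) summable_on UNIV"
  proof (rule summable_on_comparison_test)
    show "(\<lambda>n. norm (x n) powr r) summable_on UNIV" using x 2 by (simp add: lp_space_def)
    show "norm (y n) powr r \<le> norm (x n) powr r" for n
      using 2 le by (intro powr_mono2) auto
  qed auto
  then show ?thesis using 2 by (simp add: lp_space_def)
qed

lemma lp_space_cscale: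
  assumes p: "1 \<le> p" and x: "x \<in> lp_space p"
  shows "cscale c x \<in> lp_space p"
  using p
proof (cases rule: ereal_ge_1_cases)
  case 1
  then show ?thesis using x by (auto simp: lp_space_def cscale_def intro: tendsto_mult_right_zero)
next
  case (2 r)
  then show ?thesis using x
    by (auto simp: lp_space_def cscale_def norm_mult powr_mult intro: summable_on_cmult_right)
qed

lemma lp_space_add:
  assumes p: "1 \<le> p" and x: "x \<in> lp_space p" and y: "y \<in> lp_space p"
  shows "x + y \<in> lp_space p"
  using p
proof (cases rule: ereal_ge_1_cases)
  case 1
  then show ?thesis using x y tendsto_add[of x 0 cofinite y 0]
    by (simp add: lp_space_def plus_fun_def)
next
  case (2 r)
  have le: "norm (x n + y n) powr r \<le> 2 powr r * (norm (x n) powr r + norm (y n) powr r)" for n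
  proof -
    have "norm (x n + y n) \<le> 2 * max (norm (x n)) (norm (y n))"
      using norm_triangle_ineq[of "x n" "y n"] by linarith
    then have "norm (x n + y n) powr r \<le> (2 * max (norm (x n)) (norm (y n))) powr r"
      using 2 by (intro powr_mono2) auto
    also have "\<dots> = 2 powr r * max (norm (x n)) (norm (y n)) powr r"
      by (simp add: powr_mult)
    also have "\<dots> \<le> 2 powr r * (norm (x n) powr r + norm (y n) powr r)"
      by (intro mult_left_mono) (auto simp: max_def)
    finally show ?thesis .
  qed
  have "(\<lambda>n. 2 powr r * (norm (x n) powr r + norm (y n) powr r)) summable_on UNIV"
    using x y 2 by (intro summable_on_cmult_right summable_on_add) (auto simp: lp_space_def)
  then have "(\<lambda>n. norm (x n + y n) powr r) summable_on UNIV"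
    by (rule summable_on_comparison_test) (auto simp: le)
  then show ?thesis using 2 by (simp add: lp_space_def)
qed

lemma subspace_lp_space:
  assumes "1 \<le> p"
  shows "module.subspace cscale (lp_space p)"
proof -
  have "(0 :: int \<Rightarrow> complex) \<in> lp_space p"
    using assms by (auto simp: lp_space_def zero_fun_def)
  then show ?thesis
    using assms by (auto simp: module.subspace_def[OF module_cscale] lp_space_add lp_space_cscale)
qed

lemma bounded_operator_bilateral_shift:
  assumes w: "bounded (range w)" and p: "1 \<le> p"
  shows "bounded_operator (lp_space p) (lp_norm p) (bilateral_shift w)"
proof -
  obtain C where C: "C > 0" "\<And>n. norm (w n) \<le> C"
    using w by (auto simp: bounded_pos)
  have key: "bilateral_shift w x \<in> lp_space p \<and> lp_norm p (bilateral_shift w x) \<le> C * lp_norm p x"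
    if x: "x \<in> lp_space p" for x
    using p
  proof (cases rule: ereal_ge_1_cases)
    case 1
    have x0: "(x \<longlongrightarrow> 0) cofinite" using x 1 by (simp add: lp_space_def)
    have "filterlim (\<lambda>n::int. n + 1) cofinite cofinite"
      unfolding filterlim_iff
    proof (intro allI impI)
      fix P :: "int \<Rightarrow> bool" assume "eventually P cofinite"
      then have "finite ((\<lambda>n. n + 1) -` {n. \<not> P n})"
        by (intro finite_vimageI) (auto simp: eventually_cofinite)
      then show "\<forall>\<^sub>F n in cofinite. P (n + 1)"
        by (simp add: eventually_cofinite vimage_def)
    qed
    then have "((\<lambda>n. x (n + 1)) \<longlongrightarrow> 0) cofinite"
      using filterlim_compose[OF x0] by blast
    then have "((\<lambda>n. C * norm (x (n + 1))) \<longlongrightarrow> 0) cofinite"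
      by (intro tendsto_mult_right_zero tendsto_norm_zero)
    then have "(bilateral_shift w x \<longlongrightarrow> 0) cofinite"
      by (rule Lim_null_comparison[rotated])
        (auto simp: bilateral_shift_def norm_mult intro!: always_eventually mult_right_mono C)
    moreover have "(SUP n. norm (bilateral_shift w x n)) \<le> C * (SUP n. norm (x n))"
    proof (rule cSUP_least)
      fix n
      have "norm (x (n + 1)) \<le> (SUP n. norm (x n))"
        using c0_bdd_above[OF x0] by (intro cSUP_upper) auto
      then show "norm (bilateral_shift w x n) \<le> C * (SUP n. norm (x n))"
        using C by (auto simp: bilateral_shift_def norm_mult intro!: mult_mono)
    qed auto
    ultimately show ?thesis using 1 by (simp add: lp_space_def lp_norm_def)
  next
    case (2 r)
    let ?f = "\<lambda>n. norm (x n) powr r"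
    have sx: "?f summable_on UNIV" using x 2 by (simp add: lp_space_def)
    have sx': "(\<lambda>n. ?f (n + 1)) summable_on UNIV"
      using summable_on_reindex_bij_betw[OF shift_int_bij, of ?f] sx by simp
    have eq: "(\<Sum>\<^sub>\<infinity>n. ?f (n + 1)) = (\<Sum>\<^sub>\<infinity>n. ?f n)"
      using infsum_reindex_bij_betw[OF shift_int_bij, of ?f] by simp
    have le: "norm (bilateral_shift w x n) powr r \<le> C powr r * ?f (n + 1)" for n
    proof -
      have "norm (bilateral_shift w x n) powr r \<le> (C * norm (x (n + 1))) powr r"
        using 2 C by (auto simp: bilateral_shift_def norm_mult intro!: powr_mono2 mult_right_mono)
      then show ?thesis using C by (simp add: powr_mult)
    qed
    have s: "(\<lambda>n. norm (bilateral_shift w x n) powr r) summable_on UNIV"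
      by (rule summable_on_comparison_test[OF summable_on_cmult_right[OF sx', of "C powr r"]])
        (auto simp: le)
    have "(\<Sum>\<^sub>\<infinity>n. norm (bilateral_shift w x n) powr r) \<le> (\<Sum>\<^sub>\<infinity>n. C powr r * ?f (n + 1))"
      by (intro infsum_mono s summable_on_cmult_right sx' le)
    also have "\<dots> = C powr r * (\<Sum>\<^sub>\<infinity>n. ?f n)"
      by (simp add: infsum_cmult_right' eq)
    finally have "(\<Sum>\<^sub>\<infinity>n. norm (bilateral_shift w x n) powr r) powr (1/r)
        \<le> (C powr r * (\<Sum>\<^sub>\<infinity>n. ?f n)) powr (1/r)"
      using 2 by (intro powr_mono2) (auto intro!: infsum_nonneg)
    also have "\<dots> = C * (\<Sum>\<^sub>\<infinity>n. ?f n) powr (1/r)"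
      using 2 C by (simp add: powr_mult powr_powr infsum_nonneg)
    finally show ?thesis using 2 s by (simp add: lp_space_def lp_norm_def)
  qed
  have "bilateral_shift w (x + y) = bilateral_shift w x + bilateral_shift w y" for x y
    by (auto simp: bilateral_shift_def fun_eq_iff algebra_simps)
  moreover have "bilateral_shift w (cscale c x) = cscale c (bilateral_shift w x)" for c x
    by (auto simp: bilateral_shift_def cscale_def fun_eq_iff)
  ultimately show ?thesis using key unfolding bounded_operator_def by blast
qed

lemma lp_norm_truncation:
  assumes p: "1 \<le> p" and x: "x \<in> lp_space p" and e: "e > 0"
  obtains F where "finite F" "lp_norm p (\<lambda>n. if n \<in> F then 0 else x n) \<le> e"
  using p
proof (cases rule: ereal_ge_1_cases)
  case 1
  define F where "F = {n. \<not> norm (x n) < e}"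
  have "finite F"
    using x 1 tendstoD[of x 0 cofinite e] e
    by (simp add: lp_space_def F_def eventually_cofinite dist_norm)
  moreover have "lp_norm p (\<lambda>n. if n \<in> F then 0 else x n) \<le> e"
    using 1 e by (auto simp: lp_norm_def F_def intro!: cSUP_least)
  ultimately show thesis by (rule that)
next
  case (2 r)
  let ?f = "\<lambda>n. norm (x n) powr r"
  have s: "?f summable_on UNIV" using x 2 by (simp add: lp_space_def)
  obtain F where F: "finite F" "dist (sum ?f F) (infsum ?f UNIV) \<le> e powr r"
    using infsum_finite_approximation[OF s, of "e powr r"] e by auto
  have sF: "?f summable_on F" "?f summable_on (- F)"
    using s by (auto intro: summable_on_subset_banach)
  have "infsum ?f UNIV = sum ?f F + infsum ?f (- F)"
    using infsum_Un_disjoint[OF sF] F by (simp add: Compl_partition)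
  then have "infsum ?f (- F) \<le> e powr r"
    using F by (simp add: dist_real_def)
  moreover have "(\<Sum>\<^sub>\<infinity>n. norm (if n \<in> F then 0 else x n) powr r) = infsum ?f (- F)"
    by (rule infsum_cong_neutral) auto
  ultimately have "(\<Sum>\<^sub>\<infinity>n. norm (if n \<in> F then 0 else x n) powr r) powr (1/r)
      \<le> (e powr r) powr (1/r)"
    using 2 by (intro powr_mono2) (auto intro!: infsum_nonneg)
  then have "lp_norm p (\<lambda>n. if n \<in> F then 0 else x n) \<le> e"
    using 2 e by (simp add: lp_norm_def powr_powr)
  with F show thesis by (intro that)
qed

lemma bilateral_shift_unique:
  assumes w: "bounded (range w)" and p: "1 \<le> p"
    and T: "bounded_operator (lp_space p) (lp_norm p) T"
    and Te: "\<And>n. T (basis_vec n) = cscale (w n) (basis_vec (n - 1))"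
    and x: "x \<in> lp_space p"
  shows "T x = bilateral_shift w x"
proof
  fix k
  let ?S = "bilateral_shift w" and ?B = "lp_space p" and ?N = "lp_norm p"
  have S: "bounded_operator ?B ?N ?S"
    using bounded_operator_bilateral_shift[OF w p] .
  have zero: "(0 :: int \<Rightarrow> complex) \<in> ?B"
    using module.subspace_0[OF module_cscale subspace_lp_space[OF p]] .
  have basis: "basis_vec n \<in> ?B" for n
  proof (cases "p = \<infinity>")
    case False
    have "(\<lambda>k. norm (basis_vec n k) powr real_of_ereal p) summable_on {n}"
      by simp
    then have "(\<lambda>k. norm (basis_vec n k) powr real_of_ereal p) summable_on UNIV"
      by (rule summable_on_cong_neutral[THEN iffD1, rotated -1]) (auto simp: basis_vec_def)
    then show ?thesis using False by (simp add: lp_space_def)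
  next
    case True
    have "finite {k. \<not> basis_vec n k = 0}"
      by (rule finite_subset[of _ "{n}"]) (auto simp: basis_vec_def)
    then have "\<forall>\<^sub>F k in cofinite. basis_vec n k = 0" by (simp add: eventually_cofinite)
    then show ?thesis using True by (simp add: lp_space_def tendsto_eventually)
  qed
  have fin: "(\<lambda>n. if n \<in> F then x n else 0) \<in> ?B \<and>
      T (\<lambda>n. if n \<in> F then x n else 0) = ?S (\<lambda>n. if n \<in> F then x n else 0)"
    if "finite F" for F
    using that
  proof induction
    case empty
    have z: "(\<lambda>n. 0) = (0 :: int \<Rightarrow> complex)" "cscale 0 (0 :: int \<Rightarrow> complex) = 0"
      by (auto simp: cscale_def fun_eq_iff)
    have "T (cscale 0 0) = cscale 0 (T 0)"
      using T zero unfolding bounded_operator_def by blast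
    then have "T 0 = 0" using z by (simp add: cscale_def fun_eq_iff)
    moreover have "?S 0 = 0" by (simp add: bilateral_shift_def fun_eq_iff)
    ultimately show ?case using zero z(1) by simp
  next
    case (insert m F)
    let ?y = "\<lambda>n. if n \<in> F then x n else 0"
    have eq: "(\<lambda>n. if n \<in> insert m F then x n else 0) = cscale (x m) (basis_vec m) + ?y"
      using insert by (auto simp: cscale_def basis_vec_def fun_eq_iff)
    have m: "cscale (x m) (basis_vec m) \<in> ?B" using lp_space_cscale[OF p basis] .
    have "T (cscale (x m) (basis_vec m) + ?y) = T (cscale (x m) (basis_vec m)) + T ?y"
      using T m insert.IH unfolding bounded_operator_def by blast
    also have "T (cscale (x m) (basis_vec m)) = cscale (x m) (T (basis_vec m))"
      using T basis unfolding bounded_operator_def by blast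
    also have "T (basis_vec m) = ?S (basis_vec m)"
      by (simp add: Te bilateral_shift_basis_vec)
    also have "cscale (x m) (?S (basis_vec m)) = ?S (cscale (x m) (basis_vec m))"
      using S basis unfolding bounded_operator_def by metis
    also have "T ?y = ?S ?y" using insert.IH by blast
    also have "?S (cscale (x m) (basis_vec m)) + ?S ?y = ?S (cscale (x m) (basis_vec m) + ?y)"
      using S m insert.IH unfolding bounded_operator_def by metis
    finally show ?case using lp_space_add[OF p m] insert.IH eq by metis
  qed
  obtain C1 where C1: "\<And>y. y \<in> ?B \<Longrightarrow> ?N (T y) \<le> C1 * ?N y"
    using T unfolding bounded_operator_def by blast
  obtain C2 where C2: "\<And>y. y \<in> ?B \<Longrightarrow> ?N (?S y) \<le> C2 * ?N y"
    using S unfolding bounded_operator_def by blast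
  have bound: "norm (T x k - ?S x k) \<le> (\<bar>C1\<bar> + \<bar>C2\<bar>) * e" if e: "e > 0" for e
  proof -
    obtain F where F: "finite F" "?N (\<lambda>n. if n \<in> F then 0 else x n) \<le> e"
      using lp_norm_truncation[OF p x e] .
    let ?y = "\<lambda>n. if n \<in> F then x n else 0" and ?r = "\<lambda>n. if n \<in> F then 0 else x n"
    have r: "?r \<in> ?B" by (rule lp_space_dominated[OF p x]) auto
    have y: "?y \<in> ?B" "T ?y = ?S ?y" using fin[OF F(1)] by auto
    have eq: "x = ?y + ?r" by (auto simp: fun_eq_iff)
    have N0: "?N ?r \<ge> 0" using coord_le_lp_norm[OF p r, of 0] norm_ge_zero order_trans by blast
    have "T x = T ?y + T ?r" using T y r eq unfolding bounded_operator_def by metis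
    moreover have "?S x = ?S ?y + ?S ?r" using S y r eq unfolding bounded_operator_def by metis
    ultimately have "T x k - ?S x k = T ?r k - ?S ?r k" using y(2) by simp
    also have "norm \<dots> \<le> norm (T ?r k) + norm (?S ?r k)" by (rule norm_triangle_ineq4)
    also have "\<dots> \<le> ?N (T ?r) + ?N (?S ?r)"
      using T S r unfolding bounded_operator_def by (intro add_mono coord_le_lp_norm p) auto
    also have "\<dots> \<le> C1 * ?N ?r + C2 * ?N ?r" by (intro add_mono C1 C2 r)
    also have "\<dots> \<le> (\<bar>C1\<bar> + \<bar>C2\<bar>) * ?N ?r"
      using N0 by (simp add: distrib_right add_mono mult_right_mono)
    also have "\<dots> \<le> (\<bar>C1\<bar> + \<bar>C2\<bar>) * e" using F by (intro mult_left_mono) auto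
    finally show ?thesis .
  qed
  have "norm (T x k - ?S x k) \<le> 0"
  proof (rule field_le_epsilon)
    fix d :: real assume d: "d > 0"
    let ?K = "\<bar>C1\<bar> + \<bar>C2\<bar> + 1"
    have "norm (T x k - ?S x k) \<le> (\<bar>C1\<bar> + \<bar>C2\<bar>) * (d / ?K)"
      using d by (intro bound divide_pos_pos) auto
    also have "\<dots> \<le> ?K * (d / ?K)" using d by (intro mult_right_mono) auto
    also have "\<dots> = d" by (simp add: add_nonneg_pos)
    finally show "norm (T x k - ?S x k) \<le> 0 + d" by simp
  qed
  then show "T x k = ?S x k" by simp
qed

end

theory Submission
  imports Defs "HOL-Computational_Algebra.Polynomial"
begin

text \<open>
  Rescaling the basis vectors gives vectors \<open>f\<^sub>n\<close> (\<open>shift_vec w n\<close> below) which \<open>T\<close> translates,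
  \<open>T f\<^sub>n = f\<^sub>n\<^sub>-\<^sub>1\<close>, so all the weights move into the norms \<open>\<parallel>f\<^sub>n\<parallel> = w~(n+1, 0) / w~(1, n)\<close>. In these
  terms the hypothesis says that for every fixed \<open>a\<close> the quantity
  \<open>\<parallel>f\<^sub>a\<^sub>-\<^sub>1\<^sub>-\<^sub>j\<^sub>m\<parallel> \<parallel>f\<^sub>m\<parallel>\<^sup>j\<close> is arbitrarily small for some arbitrarily large \<open>m\<close>.

  The norm of the exponent \<open>1\<close> dominates that of every other exponent and finitely supported families
  are dense for all of them, while \<open>\<parallel>f\<^sub>n\<parallel>\<close> is the same for all of them. So it suffices to find a vector
  \<open>x\<close>, absolutely summable, such that every \<open>f\<^sub>n\<close> is a limit of vectors \<open>q(T) x\<close>, \<open>q\<close> a polynomial, in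
  the norm of exponent \<open>1\<close>. For given \<open>n\<close> and \<open>\<epsilon>\<close> the vectors \<open>x\<close> with
  \<open>\<parallel>q(T) x - f\<^sub>n\<parallel> < \<epsilon>\<close> for some \<open>q\<close> form an open set; by the theorem of Baire, only its density has to be
  shown (\<open>exists_vector_approximating_shift_vecs\<close>).

  For density (\<open>perturbation_reaches_shift_vec\<close>) take a finitely supported vector \<open>x = p(T) f\<^sub>k\<close> and a
  large \<open>M\<close>, and perturb \<open>x\<close> to \<open>y = x + \<delta> f\<^sub>M\<close>. With \<open>m = M - k\<close> and \<open>A(z) = p(z) z\<^sup>m\<close> this is
  \<open>y = (\<delta> + A(T)) f\<^sub>M\<close>. The polynomial \<open>\<delta> + A\<close> divides \<open>\<delta>\<^sup>j - (-A)\<^sup>j\<close>, the quotient being a truncated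
  geometric series for the inverse of \<open>\<delta> + A\<close>. Hence some \<open>q\<close> gives
  \<open>q(T) y = T\<^sup>M\<^sup>-\<^sup>n (1 - \<delta>\<^sup>-\<^sup>j (-A(T))\<^sup>j) f\<^sub>M\<close>, which differs from \<open>f\<^sub>n\<close> by
  \<open>\<plusminus> \<delta>\<^sup>-\<^sup>j p(T)\<^sup>j f\<^sub>n\<^sub>-\<^sub>j\<^sub>m\<close>. If \<open>\<delta>\<close> is chosen so that \<open>\<delta> \<parallel>f\<^sub>M\<parallel>\<close> is a fixed small number, then this error
  is at most a constant times \<open>\<parallel>f\<^sub>n\<^sub>+\<^sub>j\<^sub>k\<^sub>-\<^sub>j\<^sub>M\<parallel> \<parallel>f\<^sub>M\<parallel>\<^sup>j\<close>, and the hypothesis provides an \<open>M\<close> that makes it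
  small.
\<close>

section \<open>The space of absolutely summable families\<close>

lemma mem_lp_space_1: "x \<in> lp_space 1 \<longleftrightarrow> (\<lambda>n. norm (x n)) summable_on UNIV"
  by (simp add: lp_space_def one_ereal_def)

lemma lp_norm_1: "lp_norm 1 x = (\<Sum>\<^sub>\<infinity>n. norm (x n))"
  by (simp add: lp_norm_def one_ereal_def infsum_nonneg)

lemma lp_norm_nonneg: "lp_norm p x \<ge> 0" if "1 \<le> p" "x \<in> lp_space p"
  using coord_le_lp_norm[OF that, of 0] norm_ge_zero order_trans by blast

lemma lp_norm_1_nonneg: "lp_norm 1 x \<ge> 0"
  by (simp add: lp_norm_1 infsum_nonneg)

lemma lp_norm_1_triangle:
  assumes "x \<in> lp_space 1" "y \<in> lp_space 1"
  shows "lp_norm 1 (x + y) \<le> lp_norm 1 x + lp_norm 1 y"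
proof -
  have "(\<Sum>\<^sub>\<infinity>n. norm ((x + y) n)) \<le> (\<Sum>\<^sub>\<infinity>n. norm (x n) + norm (y n))"
    using assms lp_space_add[OF _ assms]
    by (intro infsum_mono summable_on_add) (auto simp: mem_lp_space_1 intro: norm_triangle_ineq)
  also have "\<dots> = lp_norm 1 x + lp_norm 1 y"
    using assms by (simp add: infsum_add mem_lp_space_1 lp_norm_1)
  finally show ?thesis by (simp add: lp_norm_1)
qed

lemma lp_norm_1_cscale: "lp_norm 1 (cscale c x) = norm c * lp_norm 1 x"
  by (simp add: lp_norm_1 cscale_def norm_mult infsum_cmult_right')

lemma lp_norm_1_minus_commute: "lp_norm 1 (x - y) = lp_norm 1 (y - x)"
  by (simp add: lp_norm_1 norm_minus_commute)

lemma lp_space_diff: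
  assumes "1 \<le> p" "x \<in> lp_space p" "y \<in> lp_space p"
  shows "x - y \<in> lp_space p"
  using module.subspace_diff[OF module_cscale subspace_lp_space[OF assms(1)]] assms by blast

lemma basis_vec_mem_lp_space_1: "basis_vec n \<in> lp_space 1"
  and lp_norm_1_basis_vec: "lp_norm 1 (basis_vec n) = 1"
proof -
  have "((\<lambda>k. norm (basis_vec n k)) has_sum 1) {n}"
    using has_sum_finite[of "{n}" "\<lambda>k. norm (basis_vec n k)"] by (simp add: basis_vec_def)
  then have "((\<lambda>k. norm (basis_vec n k)) has_sum 1) UNIV"
    by (rule has_sum_cong_neutral[THEN iffD1, rotated -1]) (auto simp: basis_vec_def)
  then show "basis_vec n \<in> lp_space 1" "lp_norm 1 (basis_vec n) = 1"
    by (auto simp: mem_lp_space_1 lp_norm_1 infsumI has_sum_imp_summable)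
qed

text \<open>
  For \<open>r \<ge> 1\<close> and \<open>S = \<Sum>\<bar>x\<^sub>n\<bar>\<close> one has \<open>\<bar>x\<^sub>n\<bar>\<^sup>r \<le> S\<^sup>r\<^sup>-\<^sup>1 \<bar>x\<^sub>n\<bar>\<close>. Summing over \<open>n\<close> bounds the exponent
  \<open>r\<close> by the exponent \<open>1\<close>, and this is why a construction made for \<open>p = 1\<close> serves all \<open>p\<close>.
\<close>

lemma lp_space_1_subset_and_norm_le:
  assumes p: "1 \<le> p" and x: "x \<in> lp_space 1"
  shows "x \<in> lp_space p \<and> lp_norm p x \<le> lp_norm 1 x"
  using p
proof (cases rule: ereal_ge_1_cases)
  case 1
  have "finite {n. \<not> norm (x n) < e}" if e: "e > 0" for e
  proof -
    obtain F where F: "finite F" "lp_norm 1 (\<lambda>n. if n \<in> F then 0 else x n) \<le> e / 2"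
      using lp_norm_truncation[OF _ x, of "e / 2"] e by auto
    have "norm (x n) < e" if "n \<notin> F" for n
      using coord_le_lp_norm[of 1 "\<lambda>n. if n \<in> F then 0 else x n" n] F e that
        lp_space_dominated[OF order.refl x, of "\<lambda>n. if n \<in> F then 0 else x n"] by auto
    then have "{n. \<not> norm (x n) < e} \<subseteq> F" by auto
    then show ?thesis using F finite_subset by blast
  qed
  then have "(x \<longlongrightarrow> 0) cofinite"
    by (intro tendstoI) (simp add: eventually_cofinite dist_norm)
  moreover have "(SUP n. norm (x n)) \<le> lp_norm 1 x"
    using coord_le_lp_norm[OF _ x] by (intro cSUP_least) auto
  ultimately show ?thesis using 1 by (simp add: lp_space_def lp_norm_def)
next
  case (2 r)
  let ?S = "lp_norm 1 x"
  have sx: "(\<lambda>n. norm (x n)) summable_on UNIV" using x by (simp add: mem_lp_space_1)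
  have le: "norm (x n) powr r \<le> ?S powr (r - 1) * norm (x n)" for n
  proof -
    have "norm (x n) powr r = norm (x n) powr (r - 1) * norm (x n)"
      by (simp add: powr_mult_base powr_diff)
    also have "\<dots> \<le> ?S powr (r - 1) * norm (x n)"
      using coord_le_lp_norm[OF _ x] 2 by (intro mult_right_mono powr_mono2) auto
    finally show ?thesis .
  qed
  have s: "(\<lambda>n. norm (x n) powr r) summable_on UNIV"
    by (rule summable_on_comparison_test[OF summable_on_cmult_right[OF sx]]) (auto intro: le)
  have "(\<Sum>\<^sub>\<infinity>n. norm (x n) powr r) \<le> (\<Sum>\<^sub>\<infinity>n. ?S powr (r - 1) * norm (x n))"
    by (intro infsum_mono s summable_on_cmult_right sx le)
  also have "\<dots> = ?S powr (r - 1) * ?S"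
    by (simp add: infsum_cmult_right' lp_norm_1)
  also have "\<dots> = ?S powr r"
    using lp_norm_1_nonneg[of x] by (simp add: powr_mult_base powr_diff)
  finally have "(\<Sum>\<^sub>\<infinity>n. norm (x n) powr r) powr (1/r) \<le> (?S powr r) powr (1/r)"
    using 2 by (intro powr_mono2) (auto intro!: infsum_nonneg)
  then show ?thesis
    using 2 s lp_norm_1_nonneg[of x] by (simp add: lp_space_def lp_norm_def powr_powr)
qed

text \<open>
  A triangle inequality with a constant is enough for density statements, and unlike Minkowski's
  inequality it follows at once from \<open>\<bar>a + b\<bar> \<le> 2 max \<bar>a\<bar> \<bar>b\<bar>\<close>. One factor \<open>2\<close> comes from this bound and the
  other from estimating a sum of two terms by twice the larger one.
\<close>

lemma lp_norm_add_le:
  assumes p: "1 \<le> p" and x: "x \<in> lp_space p" and y: "y \<in> lp_space p"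
  shows "lp_norm p (x + y) \<le> 4 * max (lp_norm p x) (lp_norm p y)"
  using p
proof (cases rule: ereal_ge_1_cases)
  case 1
  have "(SUP n. norm ((x + y) n)) \<le> 4 * max (lp_norm p x) (lp_norm p y)"
  proof (rule cSUP_least)
    fix n
    show "norm ((x + y) n) \<le> 4 * max (lp_norm p x) (lp_norm p y)"
      using norm_triangle_ineq[of "x n" "y n"] coord_le_lp_norm[OF p x, of n]
        coord_le_lp_norm[OF p y, of n] lp_norm_nonneg[OF p x] lp_norm_nonneg[OF p y] by auto
  qed auto
  then show ?thesis using 1 by (simp add: lp_norm_def[of \<infinity> "x + y"])
next
  case (2 r)
  let ?m = "max (lp_norm p x) (lp_norm p y)"
  have m0: "?m \<ge> 0" using lp_norm_nonneg[OF p x] by linarith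
  have sum_le: "(\<Sum>\<^sub>\<infinity>n. norm (z n) powr r) \<le> ?m powr r" if "lp_norm p z \<le> ?m" for z
  proof -
    have "(\<Sum>\<^sub>\<infinity>n. norm (z n) powr r) = lp_norm p z powr r"
      using 2 by (simp add: lp_norm_def powr_powr infsum_nonneg)
    also have "\<dots> \<le> ?m powr r"
      using that 2 by (intro powr_mono2) (auto simp: lp_norm_def)
    finally show ?thesis .
  qed
  have le: "norm ((x + y) n) powr r \<le> 2 powr r * (norm (x n) powr r + norm (y n) powr r)" for n
  proof -
    have "norm (x n + y n) \<le> 2 * max (norm (x n)) (norm (y n))"
      using norm_triangle_ineq[of "x n" "y n"] by linarith
    then have "norm (x n + y n) powr r \<le> (2 * max (norm (x n)) (norm (y n))) powr r"
      using 2 by (intro powr_mono2) auto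
    also have "\<dots> = 2 powr r * max (norm (x n)) (norm (y n)) powr r"
      by (simp add: powr_mult)
    also have "\<dots> \<le> 2 powr r * (norm (x n) powr r + norm (y n) powr r)"
      by (intro mult_left_mono) (auto simp: max_def)
    finally show ?thesis by simp
  qed
  have sx: "(\<lambda>n. norm (x n) powr r) summable_on UNIV" and sy: "(\<lambda>n. norm (y n) powr r) summable_on UNIV"
    using x y 2 by (auto simp: lp_space_def)
  have "(\<Sum>\<^sub>\<infinity>n. norm ((x + y) n) powr r)
      \<le> (\<Sum>\<^sub>\<infinity>n. 2 powr r * (norm (x n) powr r + norm (y n) powr r))"
    using lp_space_add[OF p x y] 2
    by (intro infsum_mono summable_on_cmult_right summable_on_add sx sy le) (auto simp: lp_space_def)
  also have "\<dots> = 2 powr r * ((\<Sum>\<^sub>\<infinity>n. norm (x n) powr r) + (\<Sum>\<^sub>\<infinity>n. norm (y n) powr r))"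
    by (simp add: infsum_cmult_right' infsum_add sx sy)
  also have "\<dots> \<le> 2 powr r * (?m powr r + ?m powr r)"
    by (intro mult_left_mono add_mono sum_le) auto
  also have "\<dots> \<le> 2 powr r * (2 powr r * ?m powr r)"
  proof (intro mult_left_mono)
    have "(2::real) powr 1 \<le> 2 powr r" using 2 by (intro powr_mono) auto
    then have "2 * ?m powr r \<le> 2 powr r * ?m powr r" by (intro mult_right_mono) auto
    then show "?m powr r + ?m powr r \<le> 2 powr r * ?m powr r" by simp
  qed auto
  also have "\<dots> = (2 * (2 * ?m)) powr r"
    using m0 by (simp only: powr_mult)
  finally have "(\<Sum>\<^sub>\<infinity>n. norm ((x + y) n) powr r) powr (1/r) \<le> ((2 * (2 * ?m)) powr r) powr (1/r)"
    using 2 by (intro powr_mono2) (auto intro!: infsum_nonneg)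
  then show ?thesis using 2 m0 by (simp add: lp_norm_def[of "ereal r" "x + y"] powr_powr)
qed

lemma Metric_space_lp_space_1: "Metric_space (lp_space 1) (\<lambda>x y. lp_norm 1 (x - y))"
proof
  fix x y z :: "int \<Rightarrow> complex"
  assume x: "x \<in> lp_space 1" and y: "y \<in> lp_space 1"
  show "(lp_norm 1 (x - y) = 0) = (x = y)"
  proof
    assume "lp_norm 1 (x - y) = 0"
    then show "x = y"
      using coord_le_lp_norm[OF _ lp_space_diff[OF _ x y]] by (auto simp: fun_eq_iff)
  qed (simp add: lp_norm_1)
  assume z: "z \<in> lp_space 1"
  have "x - z = (x - y) + (y - z)" by simp
  then show "lp_norm 1 (x - z) \<le> lp_norm 1 (x - y) + lp_norm 1 (y - z)"
    using lp_norm_1_triangle x y z lp_space_diff by (metis order.refl)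
qed (auto simp: lp_norm_1_nonneg lp_norm_1_minus_commute)

text \<open>
  A Cauchy sequence converges in each coordinate. The Cauchy estimate holds for sums over finite sets
  of coordinates, where one may pass to the limit, and these sums control the norm.
\<close>

lemma mcomplete_lp_space_1: "Metric_space.mcomplete (lp_space 1) (\<lambda>x y. lp_norm 1 (x - y))"
proof -
  interpret l1: Metric_space "lp_space 1" "\<lambda>x y. lp_norm 1 (x - y)"
    by (rule Metric_space_lp_space_1)
  have "\<exists>x. limitin l1.mtopology s x sequentially" if "l1.MCauchy s" for s
  proof -
    from that have s: "\<And>k. s k \<in> lp_space 1"
      and C: "\<And>e. e > 0 \<Longrightarrow> \<exists>K. \<forall>k l. K \<le> k \<longrightarrow> K \<le> l \<longrightarrow> lp_norm 1 (s k - s l) < e"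
      by (auto simp: l1.MCauchy_def)
    have "Cauchy (\<lambda>k. s k n)" for n
    proof (rule metric_CauchyI)
      fix e :: real assume "e > 0"
      then obtain K where "\<And>k l. K \<le> k \<Longrightarrow> K \<le> l \<Longrightarrow> lp_norm 1 (s k - s l) < e"
        using C by blast
      moreover have "dist (s k n) (s l n) \<le> lp_norm 1 (s k - s l)" for k l
        using coord_le_lp_norm[OF order.refl lp_space_diff[OF order.refl s s], of k l n] by (simp add: dist_norm)
      ultimately show "\<exists>K. \<forall>k\<ge>K. \<forall>l\<ge>K. dist (s k n) (s l n) < e"
        by (meson le_less_trans)
    qed
    then have "\<exists>a. (\<lambda>k. s k n) \<longlonglongrightarrow> a" for n
      by (simp add: Cauchy_convergent_iff convergent_def)
    then obtain x where x: "\<And>n. (\<lambda>k. s k n) \<longlonglongrightarrow> x n" by metis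
    have lim: "\<exists>K. \<forall>k\<ge>K. s k - x \<in> lp_space 1 \<and> lp_norm 1 (s k - x) \<le> e" if e: "e > 0" for e
    proof -
      obtain K where K: "\<And>k l. K \<le> k \<Longrightarrow> K \<le> l \<Longrightarrow> lp_norm 1 (s k - s l) < e"
        using C e by blast
      have "s k - x \<in> lp_space 1 \<and> lp_norm 1 (s k - x) \<le> e" if k: "k \<ge> K" for k
      proof -
        have F: "(\<Sum>n\<in>F. norm ((s k - x) n)) \<le> e" if "finite F" for F
        proof (rule LIMSEQ_le_const2)
          show "(\<lambda>l. \<Sum>n\<in>F. norm (s k n - s l n)) \<longlonglongrightarrow> (\<Sum>n\<in>F. norm ((s k - x) n))"
            by (auto intro!: tendsto_intros x)
          have "(\<Sum>n\<in>F. norm (s k n - s l n)) \<le> lp_norm 1 (s k - s l)" for l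
            using finite_sum_le_infsum[of "\<lambda>n. norm (s k n - s l n)" UNIV F] that
              lp_space_diff[OF order.refl s s, of k l] by (simp add: lp_norm_1 mem_lp_space_1)
          then show "\<exists>L. \<forall>l\<ge>L. (\<Sum>n\<in>F. norm (s k n - s l n)) \<le> e"
            using K[OF k] by (meson less_imp_le order_trans)
        qed
        have "(\<lambda>n. norm ((s k - x) n)) summable_on UNIV"
          using F by (intro nonneg_bdd_above_summable_on) (auto simp: bdd_above_def)
        moreover from this have "(\<Sum>\<^sub>\<infinity>n. norm ((s k - x) n)) \<le> e"
          using F by (intro infsum_le_finite_sums) auto
        ultimately show ?thesis by (simp add: mem_lp_space_1 lp_norm_1)
      qed
      then show ?thesis by blast
    qed
    obtain K where "s K - x \<in> lp_space 1" using lim[of 1] by auto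
    then have "s K - (s K - x) \<in> lp_space 1" using s lp_space_diff[OF order.refl] by blast
    then have "x \<in> lp_space 1" by simp
    moreover have "\<exists>K. \<forall>k\<ge>K. lp_norm 1 (s k - x) < e" if e: "e > 0" for e
    proof -
      obtain K where K: "\<And>k. k \<ge> K \<Longrightarrow> lp_norm 1 (s k - x) \<le> e / 2"
        using lim[of "e / 2"] e by auto
      have "lp_norm 1 (s k - x) < e" if "k \<ge> K" for k
        using K[OF that] e by linarith
      then show ?thesis by blast
    qed
    ultimately have "limitin l1.mtopology s x sequentially"
      using s by (simp add: l1.limit_metric_sequentially)
    then show ?thesis by blast
  qed
  then show ?thesis by (simp add: l1.mcomplete_def)
qed

section \<open>Polynomials in a linear operator\<close>

definition poly_apply ::
    "(('a \<Rightarrow> complex) \<Rightarrow> ('a \<Rightarrow> complex)) \<Rightarrow> complex poly \<Rightarrow> ('a \<Rightarrow> complex) \<Rightarrow> ('a \<Rightarrow> complex)" where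
  "poly_apply T q x = (\<Sum>i\<le>degree q. cscale (coeff q i) ((T ^^ i) x))"

lemma cscale_simps [simp]:
  "cscale 0 x = 0" "cscale 1 x = x" "cscale c (0 :: 'a \<Rightarrow> complex) = 0"
  "cscale c (cscale d x) = cscale (c * d) x"
  by (auto simp: cscale_def fun_eq_iff)

lemma cscale_add: "cscale c (x + y) = cscale c x + cscale c y"
  and cscale_add_left: "cscale (c + d) x = cscale c x + cscale d x"
  by (auto simp: cscale_def fun_eq_iff algebra_simps)

lemma poly_apply_mem_span:
  "poly_apply T q x \<in> module.span cscale (range (\<lambda>n. (T ^^ n) x))"
  unfolding poly_apply_def
  by (intro module.span_sum module.span_scale module.span_base module_cscale) auto

lemma poly_apply_0 [simp]: "poly_apply T 0 x = 0"
  by (simp add: poly_apply_def)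

lemma poly_apply_pCons [simp]:
  assumes "module_hom cscale cscale T"
  shows "poly_apply T (pCons a p) x = cscale a x + T (poly_apply T p x)"
proof (cases "p = 0")
  case True
  then show ?thesis using module_hom.zero[OF assms] by (simp add: poly_apply_def)
next
  case False
  then have "poly_apply T (pCons a p) x
      = cscale a x + (\<Sum>i\<le>degree p. cscale (coeff p i) (T ((T ^^ i) x)))"
    by (simp add: poly_apply_def sum.atMost_Suc_shift del: sum.atMost_Suc)
  then show ?thesis
    by (simp add: poly_apply_def module_hom.sum[OF assms] module_hom.scale[OF assms])
qed

lemma poly_apply_add:
  assumes "module_hom cscale cscale T"
  shows "poly_apply T (p + q) x = poly_apply T p x + poly_apply T q x"
proof (induction p q rule: poly_induct2)
  case 0
  show "poly_apply T (0 + 0) x = poly_apply T 0 x + poly_apply T 0 x" by simp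
next
  case (pCons a p b q)
  have IH: "poly_apply T (p + q) x = poly_apply T p x + poly_apply T q x"
    by (rule pCons.IH)
  have "poly_apply T (pCons a p + pCons b q) x
      = cscale a x + cscale b x + T (poly_apply T p x + poly_apply T q x)"
    by (simp add: assms IH cscale_add_left)
  then show "poly_apply T (pCons a p + pCons b q) x
      = poly_apply T (pCons a p) x + poly_apply T (pCons b q) x"
    by (simp add: assms module_hom.add[OF assms])
qed

lemma poly_apply_smult:
  assumes "module_hom cscale cscale T"
  shows "poly_apply T (smult c p) x = cscale c (poly_apply T p x)"
proof (induction p)
  case 0
  show "poly_apply T (smult c 0) x = cscale c (poly_apply T 0 x)" by simp
next
  case (pCons a p)
  show "poly_apply T (smult c (pCons a p)) x = cscale c (poly_apply T (pCons a p) x)"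
    by (simp add: assms cscale_add module_hom.scale[OF assms] pCons.IH)
qed

lemma poly_apply_mult:
  assumes "module_hom cscale cscale T"
  shows "poly_apply T (p * q) x = poly_apply T p (poly_apply T q x)"
  by (induction p) (simp_all add: assms poly_apply_add poly_apply_smult)

lemma poly_apply_monom:
  assumes "module_hom cscale cscale T"
  shows "poly_apply T (monom c n) x = cscale c ((T ^^ n) x)"
proof (induction n)
  case 0
  then show ?case using module_hom.zero[OF assms] by (simp add: monom_0 assms)
next
  case (Suc n)
  then show ?case by (simp add: monom_Suc assms module_hom.scale[OF assms])
qed

lemma poly_apply_diff:
  assumes "module_hom cscale cscale T"
  shows "poly_apply T q (x - y) = poly_apply T q x - poly_apply T q y"
proof (induction q)
  case 0
  show "poly_apply T 0 (x - y) = poly_apply T 0 x - poly_apply T 0 y" by simp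
next
  case (pCons a q)
  have IH: "poly_apply T q (x - y) = poly_apply T q x - poly_apply T q y"
    by (rule pCons.IH)
  have "poly_apply T (pCons a q) (x - y)
      = cscale a x - cscale a y + T (poly_apply T q x - poly_apply T q y)"
    by (simp add: assms IH module.scale_right_diff_distrib[OF module_cscale])
  then show "poly_apply T (pCons a q) (x - y) = poly_apply T (pCons a q) x - poly_apply T (pCons a q) y"
    by (simp add: assms module_hom.diff[OF assms])
qed

lemma module_hom_bilateral_shift: "module_hom cscale cscale (bilateral_shift w)"
  by unfold_locales (auto simp: module_cscale bilateral_shift_def cscale_def fun_eq_iff algebra_simps)

text \<open>
  Each \<open>q(T)\<close> is continuous, which makes the sets in the category argument open and lets an
  approximation of \<open>f\<^sub>k\<close> be transported to \<open>p(T) f\<^sub>k\<close>.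
\<close>

lemma poly_apply_bounded:
  assumes T: "module_hom cscale cscale T" "bounded_operator (lp_space 1) (lp_norm 1) T"
  shows "\<exists>K>0. \<forall>x\<in>lp_space 1. poly_apply T q x \<in> lp_space 1 \<and>
           lp_norm 1 (poly_apply T q x) \<le> K * lp_norm 1 x"
proof (induction q)
  case 0
  have "(0 :: int \<Rightarrow> complex) \<in> lp_space 1" "lp_norm 1 0 = 0" by (auto simp: mem_lp_space_1 lp_norm_1)
  then have "poly_apply T 0 x \<in> lp_space 1 \<and> lp_norm 1 (poly_apply T 0 x) \<le> 1 * lp_norm 1 x" for x
    by (simp add: lp_norm_1_nonneg)
  then show ?case using zero_less_one by blast
next
  case (pCons a q)
  obtain K where K: "K > 0" "\<And>x. x \<in> lp_space 1 \<Longrightarrow> poly_apply T q x \<in> lp_space 1"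
    "\<And>x. x \<in> lp_space 1 \<Longrightarrow> lp_norm 1 (poly_apply T q x) \<le> K * lp_norm 1 x"
    using pCons.IH by blast
  obtain C where C: "\<And>x. x \<in> lp_space 1 \<Longrightarrow> T x \<in> lp_space 1"
    "\<And>x. x \<in> lp_space 1 \<Longrightarrow> lp_norm 1 (T x) \<le> C * lp_norm 1 x"
    using T(2) unfolding bounded_operator_def by blast
  have "poly_apply T (pCons a q) x \<in> lp_space 1 \<and>
      lp_norm 1 (poly_apply T (pCons a q) x) \<le> (norm a + \<bar>C\<bar> * K + 1) * lp_norm 1 x"
    if x: "x \<in> lp_space 1" for x
  proof
    have m: "cscale a x \<in> lp_space 1" "T (poly_apply T q x) \<in> lp_space 1"
      using x K C lp_space_cscale by auto
    then show "poly_apply T (pCons a q) x \<in> lp_space 1"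
      by (simp add: T lp_space_add)
    have "lp_norm 1 (poly_apply T (pCons a q) x)
        \<le> norm a * lp_norm 1 x + lp_norm 1 (T (poly_apply T q x))"
      using lp_norm_1_triangle[OF m] by (simp add: T lp_norm_1_cscale)
    also have "lp_norm 1 (T (poly_apply T q x)) \<le> \<bar>C\<bar> * lp_norm 1 (poly_apply T q x)"
      using C(2)[OF K(2)[OF x]] lp_norm_1_nonneg[of "poly_apply T q x"]
      by (meson abs_ge_self mult_right_mono order_trans)
    also have "\<dots> \<le> \<bar>C\<bar> * (K * lp_norm 1 x)"
      using K(3)[OF x] by (intro mult_left_mono) auto
    finally show "lp_norm 1 (poly_apply T (pCons a q) x) \<le> (norm a + \<bar>C\<bar> * K + 1) * lp_norm 1 x"
      using lp_norm_1_nonneg[of x] by (simp add: algebra_simps)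
  qed
  moreover have "norm a + \<bar>C\<bar> * K + 1 > 0" using K(1) by (simp add: add_nonneg_pos)
  ultimately show ?case by blast
qed

section \<open>The shift as a translation\<close>

text \<open>
  These numbers are determined by \<open>c\<^sub>0 = 1\<close> and \<open>c\<^sub>n w\<^sub>n = c\<^sub>n\<^sub>-\<^sub>1\<close>. For \<open>n \<ge> 0\<close> the product in the
  numerator is empty, for \<open>n \<le> 0\<close> the one in the denominator.
\<close>

definition shift_coeff :: "(int \<Rightarrow> complex) \<Rightarrow> int \<Rightarrow> complex" where
  "shift_coeff w n = (\<Prod>i\<in>{n+1..0}. w i) / (\<Prod>i\<in>{1..n}. w i)"

definition shift_vec :: "(int \<Rightarrow> complex) \<Rightarrow> int \<Rightarrow> int \<Rightarrow> complex" where
  "shift_vec w n = cscale (shift_coeff w n) (basis_vec n)"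

lemma shift_coeff_nonzero: "\<forall>n. w n \<noteq> 0 \<Longrightarrow> shift_coeff w n \<noteq> 0"
  by (simp add: shift_coeff_def)

lemma shift_vec_mem: "shift_vec w n \<in> lp_space 1"
  by (simp add: shift_vec_def lp_space_cscale basis_vec_mem_lp_space_1)

lemma lp_norm_1_shift_vec: "lp_norm 1 (shift_vec w n) = wtilde w (n + 1) 0 / wtilde w 1 n"
  by (simp add: shift_vec_def lp_norm_1_cscale lp_norm_1_basis_vec shift_coeff_def wtilde_def
      norm_divide prod_norm)

lemma bilateral_shift_shift_vec:
  assumes "\<forall>n. w n \<noteq> 0"
  shows "bilateral_shift w (shift_vec w n) = shift_vec w (n - 1)"
proof -
  have "shift_coeff w n * w n = shift_coeff w (n - 1)"
  proof (cases "n \<ge> 1")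
    case True
    have "{1..n} = insert n {1..n-1}" using True by auto
    then show ?thesis using True assms by (simp add: shift_coeff_def)
  next
    case False
    have "{n..0} = insert n {n+1..0}" using False by auto
    then show ?thesis using False by (simp add: shift_coeff_def)
  qed
  then show ?thesis
    by (simp add: shift_vec_def module_hom.scale[OF module_hom_bilateral_shift] bilateral_shift_basis_vec)
qed

lemma funpow_bilateral_shift_shift_vec:
  assumes "\<forall>n. w n \<noteq> 0"
  shows "(bilateral_shift w ^^ k) (shift_vec w n) = shift_vec w (n - int k)"
  by (induction k) (simp_all add: bilateral_shift_shift_vec[OF assms] algebra_simps)

text \<open>
  All \<open>f\<^sub>i\<close> with \<open>i \<le> k\<close> have the form \<open>T\<^sup>k\<^sup>-\<^sup>i f\<^sub>k\<close>. Having every large \<open>k\<close> at one's disposal allows one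
  later to choose \<open>k \<ge> \<bar>n\<bar>\<close> for a given target \<open>f\<^sub>n\<close>.
\<close>

lemma finite_support_eq_poly_apply_shift_vec:
  assumes w: "\<forall>n. w n \<noteq> 0" and F: "finite F"
  shows "\<exists>K. \<forall>k\<ge>K. \<exists>q. (\<lambda>n. if n \<in> F then x n else 0) = poly_apply (bilateral_shift w) q (shift_vec w k)"
  using F
proof induction
  case empty
  have "(\<lambda>n. if n \<in> {} then x n else 0) = poly_apply (bilateral_shift w) 0 (shift_vec w k)" for k
    by (simp add: fun_eq_iff)
  then show ?case by blast
next
  case (insert m F)
  let ?T = "bilateral_shift w"
  note T = module_hom_bilateral_shift[of w]
  obtain K where K: "\<And>k. k \<ge> K \<Longrightarrow>
      \<exists>q. (\<lambda>n. if n \<in> F then x n else 0) = poly_apply ?T q (shift_vec w k)"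
    using insert.IH by blast
  have "\<exists>q. (\<lambda>n. if n \<in> insert m F then x n else 0) = poly_apply ?T q (shift_vec w k)"
    if k: "k \<ge> max K m" for k
  proof -
    obtain q where q: "(\<lambda>n. if n \<in> F then x n else 0) = poly_apply ?T q (shift_vec w k)"
      using K k by auto
    let ?q = "monom (x m / shift_coeff w m) (nat (k - m)) + q"
    have "poly_apply ?T ?q (shift_vec w k)
        = cscale (x m / shift_coeff w m) (shift_vec w m) + (\<lambda>n. if n \<in> F then x n else 0)"
      using k by (simp add: poly_apply_add[OF T] poly_apply_monom[OF T] q
          funpow_bilateral_shift_shift_vec[OF w])
    also have "\<dots> = (\<lambda>n. if n \<in> insert m F then x n else 0)"
      using insert.hyps shift_coeff_nonzero[OF w, of m]
      by (auto simp: fun_eq_iff shift_vec_def cscale_def basis_vec_def)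
    finally show ?thesis by metis
  qed
  then show ?case by blast
qed

section \<open>Density of the approximately cyclic vectors\<close>

text \<open>
  The perturbation of \<open>x\<close> is \<open>\<delta> f\<^sub>M\<close>, and \<open>q\<close> is an approximate inverse of \<open>\<delta> + A\<close>, multiplied by a power
  of \<open>z\<close> that moves \<open>f\<^sub>M\<close> to \<open>f\<^sub>n\<close>. The condition \<open>k \<ge> \<bar>n\<bar>\<close> makes the index \<open>a\<close>, at which the limit
  condition is used, positive.
\<close>

lemma perturbation_reaches_shift_vec:
  fixes n :: int
  assumes w: "\<forall>n. w n \<noteq> 0" and bw: "bounded (range w)" and j: "j > 0"
    and lim: "\<And>a::nat. a > 0 \<Longrightarrow>
       liminf (\<lambda>m. ereal (wtilde w (int a - int j * int m) 0 / wtilde w 1 (int m) ^ j)) = 0"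
    and k: "k \<ge> \<bar>n\<bar>" and x: "x = poly_apply (bilateral_shift w) p (shift_vec w k)"
    and d: "d > 0" and e: "e > 0"
  shows "\<exists>y\<in>lp_space 1. lp_norm 1 (y - x) < d \<and>
           (\<exists>q. lp_norm 1 (poly_apply (bilateral_shift w) q y - shift_vec w n) < e)"
proof -
  let ?T = "bilateral_shift w"
  note T = module_hom_bilateral_shift[of w]
  have bT: "bounded_operator (lp_space 1) (lp_norm 1) ?T"
    using bounded_operator_bilateral_shift[OF bw] by simp
  obtain K where K: "K > 0" "\<And>x. x \<in> lp_space 1 \<Longrightarrow> lp_norm 1 (poly_apply ?T (p ^ j) x) \<le> K * lp_norm 1 x"
    using poly_apply_bounded[OF T bT] by blast
  \<comment> \<open>The error term contains \<open>f\<^sub>i\<close> with \<open>i = n - j (M - k)\<close>, whose norm is \<open>w~(i + 1, 0)\<close>, and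
    \<open>i + 1 = a - j M\<close>.\<close>
  define a where "a = n + int j * k + 1"
  have "\<bar>n\<bar> \<le> int j * k" using j k mult_right_mono[of 1 "int j" k] by linarith
  then have a: "a > 0" by (simp add: a_def)
  \<comment> \<open>The bound that the last estimate of the proof needs in order to end in \<open>e\<close>.\<close>
  define \<eta> where "\<eta> = e * (d / 2) ^ j / K"
  have \<eta>: "\<eta> > 0" using e d K by (simp add: \<eta>_def)
  have "\<exists>M::nat. int M \<ge> k + \<bar>n\<bar> \<and> wtilde w (a - int j * int M) 0 / wtilde w 1 (int M) ^ j < \<eta>"
  proof (rule ccontr)
    assume "\<not> ?thesis"
    then have "\<eta> \<le> wtilde w (a - int j * int M) 0 / wtilde w 1 (int M) ^ j" if "M \<ge> nat (k + \<bar>n\<bar>)" for M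
      using that by (meson nat_le_iff not_le)
    then have "ereal \<eta> \<le> liminf (\<lambda>M. ereal (wtilde w (int (nat a) - int j * int M) 0 / wtilde w 1 (int M) ^ j))"
      using a by (intro Liminf_bounded) (auto simp: eventually_sequentially)
    then show False using lim[of "nat a"] a \<eta> by simp
  qed
  then obtain M :: nat where M: "int M \<ge> k + \<bar>n\<bar>"
    "wtilde w (a - int j * int M) 0 / wtilde w 1 (int M) ^ j < \<eta>" by blast
  have M0: "int M \<ge> 0" "int M \<ge> k" "int M \<ge> n" using M k by auto
  define u where "u = wtilde w 1 (int M)"
  have u: "u > 0" using w by (auto simp: u_def wtilde_def intro!: prod_pos)
  \<comment> \<open>Since \<open>1 / u\<close> is the norm of \<open>f\<^sub>M\<close>, the perturbation has norm \<open>d / 2\<close>.\<close>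
  define \<delta> where "\<delta> = d / 2 * u"
  have \<delta>: "\<delta> > 0" using d u by (simp add: \<delta>_def)
  let ?c = "complex_of_real \<delta>" and ?g = "shift_vec w (int M)"
  define m where "m = nat (int M - k)"
  define A where "A = p * monom 1 m"
  have xA: "x = poly_apply ?T A ?g"
    using M0 by (simp add: x A_def poly_apply_mult[OF T] poly_apply_monom[OF T]
        funpow_bilateral_shift_shift_vec[OF w] m_def)
  define y where "y = poly_apply ?T ([:?c:] + A) ?g"
  have yx: "y = cscale ?c ?g + x"
    using module_hom.zero[OF T] by (simp add: y_def poly_apply_add[OF T] T xA)
  have x1: "x \<in> lp_space 1"
    using poly_apply_bounded[OF T bT, of A] shift_vec_mem by (auto simp: xA)
  have y1: "y \<in> lp_space 1"
    by (simp add: yx lp_space_add lp_space_cscale shift_vec_mem x1)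
  have "lp_norm 1 (y - x) = \<delta> * (1 / u)"
    using \<delta> by (simp add: yx lp_norm_1_cscale lp_norm_1_shift_vec u_def wtilde_def)
  then have close: "lp_norm 1 (y - x) < d" using u d by (simp add: \<delta>_def)
  \<comment> \<open>Up to the factor \<open>\<delta>\<^sup>j\<close>, \<open>Q\<close> is the geometric series of \<open>1 / (\<delta> + A)\<close> cut after \<open>j\<close> terms.\<close>
  obtain Q where Q: "[:?c:] ^ j - (- A) ^ j = ([:?c:] + A) * Q"
    using power_diff_sumr2[of "[:?c:]" j "- A"] by auto
  define s where "s = nat (int M - n)"
  define q where "q = smult (1 / ?c ^ j) (monom 1 s * Q)"
  define h where "h = shift_vec w (n - int j * int m)"
  have "q * ([:?c:] + A) = smult (1 / ?c ^ j) (monom 1 s * ([:?c:] ^ j - (- A) ^ j))"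
    by (simp add: q_def Q mult_ac)
  also have "\<dots> = monom 1 s + smult (- ((- 1) ^ j / ?c ^ j)) (p ^ j * monom 1 (j * m + s))"
  proof -
    have "[:?c:] ^ j = smult (?c ^ j) 1"
      by (induction j) (simp_all add: one_pCons)
    moreover have "(- A) ^ j = smult ((- 1) ^ j) (p ^ j * monom 1 (j * m))"
    proof -
      have "(- A) ^ j = smult (- 1) A ^ j" by simp
      also have "\<dots> = smult ((- 1) ^ j) (p ^ j * monom 1 (j * m))"
        by (simp only: smult_power A_def power_mult_distrib monom_power power_one mult.commute)
      finally show ?thesis .
    qed
    moreover have "monom (1 :: complex) (s + j * m) = monom 1 s * monom 1 (j * m)"
      by (simp add: mult_monom)
    ultimately show ?thesis
      using \<delta> by (simp add: algebra_simps smult_diff_right)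
  qed
  finally have qA: "q * ([:?c:] + A)
      = monom 1 s + smult (- ((- 1) ^ j / ?c ^ j)) (p ^ j * monom 1 (j * m + s))" .
  have "poly_apply ?T (monom 1 s) ?g = shift_vec w n"
    and "poly_apply ?T (monom 1 (j * m + s)) ?g = h"
    using M0 by (simp_all add: poly_apply_monom[OF T] funpow_bilateral_shift_shift_vec[OF w]
        s_def h_def algebra_simps)
  moreover have "poly_apply ?T q y = poly_apply ?T (q * ([:?c:] + A)) ?g"
    by (simp only: y_def poly_apply_mult[OF T])
  ultimately have qy: "poly_apply ?T q y
      = shift_vec w n + cscale (- ((- 1) ^ j / ?c ^ j)) (poly_apply ?T (p ^ j) h)"
    by (simp only: qA poly_apply_add[OF T] poly_apply_smult[OF T] poly_apply_mult[OF T])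
  have hN: "lp_norm 1 h = wtilde w (a - int j * int M) 0"
  proof -
    have i: "n - int j * int m + 1 = a - int j * int M"
      using M0 by (simp add: a_def m_def algebra_simps)
    have "int m \<ge> \<bar>n\<bar>" using M M0 by (simp add: m_def)
    then have "n - int j * int m \<le> 0" using j mult_right_mono[of 1 "int j" "int m"] by auto
    then show ?thesis by (simp add: h_def lp_norm_1_shift_vec i) (simp add: wtilde_def)
  qed
  have \<delta>_pow: "\<delta> ^ j = (d / 2) ^ j * u ^ j"
    by (simp only: \<delta>_def power_mult_distrib)
  have "lp_norm 1 (poly_apply ?T q y - shift_vec w n) = lp_norm 1 (poly_apply ?T (p ^ j) h) / \<delta> ^ j"
    using \<delta> by (simp add: qy lp_norm_1_cscale norm_divide norm_power)
  also have "\<dots> \<le> K * wtilde w (a - int j * int M) 0 / \<delta> ^ j"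
    using K(2)[of h] shift_vec_mem[of w "n - int j * int m"] \<delta> unfolding hN
    by (intro divide_right_mono) (simp_all add: h_def)
  also have "\<dots> = K / (d / 2) ^ j * (wtilde w (a - int j * int M) 0 / u ^ j)"
    by (simp add: \<delta>_pow)
  also have "\<dots> < K / (d / 2) ^ j * \<eta>"
    using M K d by (intro mult_strict_left_mono) (auto simp: u_def)
  also have "\<dots> = e" using K d by (simp add: \<eta>_def)
  finally show ?thesis using y1 close by blast
qed

section \<open>Cyclicity\<close>

text \<open>
  The vectors that reach \<open>f\<^sub>n\<close> up to \<open>1 / (i + 1)\<close> form an open set, by continuity of \<open>q(T)\<close>, which is dense
  because finitely supported vectors are dense and can be perturbed into it. The required vector
  lies in the intersection of these countably many sets.
\<close>

lemma exists_vector_approximating_shift_vecs: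
  assumes w: "\<forall>n. w n \<noteq> 0" and bw: "bounded (range w)" and j: "j > 0"
    and lim: "\<And>a::nat. a > 0 \<Longrightarrow>
       liminf (\<lambda>m. ereal (wtilde w (int a - int j * int m) 0 / wtilde w 1 (int m) ^ j)) = 0"
  shows "\<exists>x\<in>lp_space 1. \<forall>n. \<forall>e>0. \<exists>q. lp_norm 1 (poly_apply (bilateral_shift w) q x - shift_vec w n) < e"
proof -
  interpret l1: Metric_space "lp_space 1" "\<lambda>x y. lp_norm 1 (x - y)"
    by (rule Metric_space_lp_space_1)
  let ?T = "bilateral_shift w"
  note T = module_hom_bilateral_shift[of w]
  have bT: "bounded_operator (lp_space 1) (lp_norm 1) ?T"
    using bounded_operator_bilateral_shift[OF bw] by simp
  have mem: "poly_apply ?T q x \<in> lp_space 1" if "x \<in> lp_space 1" for q x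
    using poly_apply_bounded[OF T bT, of q] that by blast
  define G where "G = (\<lambda>(n, i::nat). {x \<in> lp_space 1.
      \<exists>q. lp_norm 1 (poly_apply ?T q x - shift_vec w n) < 1 / real (Suc i)})"
  have G: "openin l1.mtopology (G (n, i)) \<and> l1.mtopology closure_of G (n, i) = lp_space 1" for n i
  proof
    show "openin l1.mtopology (G (n, i))"
      unfolding l1.openin_mtopology
    proof (intro conjI allI impI)
      show "G (n, i) \<subseteq> lp_space 1" by (auto simp: G_def)
      fix x assume "x \<in> G (n, i)"
      then obtain q where x: "x \<in> lp_space 1"
        and q: "lp_norm 1 (poly_apply ?T q x - shift_vec w n) < 1 / real (Suc i)"
        by (auto simp: G_def)
      obtain K where K: "K > 0" "\<And>x. x \<in> lp_space 1 \<Longrightarrow> lp_norm 1 (poly_apply ?T q x) \<le> K * lp_norm 1 x"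
        using poly_apply_bounded[OF T bT] by blast
      define r where "r = (1 / real (Suc i) - lp_norm 1 (poly_apply ?T q x - shift_vec w n)) / K"
      have "y \<in> G (n, i)" if "y \<in> l1.mball x r" for y
      proof -
        have y: "y \<in> lp_space 1" "lp_norm 1 (x - y) < r" using that by auto
        have "lp_norm 1 (poly_apply ?T q y - poly_apply ?T q x) \<le> K * lp_norm 1 (x - y)"
          using K(2)[OF lp_space_diff[OF _ x y(1)]]
          by (simp add: poly_apply_diff[OF T] lp_norm_1_minus_commute)
        also have "\<dots> < K * r" using y K by simp
        also have "\<dots> = 1 / real (Suc i) - lp_norm 1 (poly_apply ?T q x - shift_vec w n)"
          using K by (simp add: r_def)
        finally have "lp_norm 1 (poly_apply ?T q y - shift_vec w n) < 1 / real (Suc i)"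
          using l1.triangle[OF mem[OF y(1), of q] mem[OF x, of q] shift_vec_mem[of w n]] by linarith
        then show ?thesis using y by (auto simp: G_def)
      qed
      moreover have "r > 0" using q K by (simp add: r_def)
      ultimately show "\<exists>r>0. l1.mball x r \<subseteq> G (n, i)" by blast
    qed
    show "l1.mtopology closure_of G (n, i) = lp_space 1"
    proof -
      have "\<exists>y\<in>G (n, i). y \<in> l1.mball x r" if x: "x \<in> lp_space 1" and r: "r > 0" for x r
      proof -
        obtain F where F: "finite F" "lp_norm 1 (\<lambda>n. if n \<in> F then 0 else x n) \<le> r / 2"
          using lp_norm_truncation[OF order.refl x, of "r / 2"] r by auto
        let ?x = "\<lambda>n. if n \<in> F then x n else 0"
        have x': "?x \<in> lp_space 1" by (rule lp_space_dominated[OF order.refl x]) auto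
        have "x - ?x = (\<lambda>n. if n \<in> F then 0 else x n)" by (auto simp: fun_eq_iff)
        then have xx': "lp_norm 1 (x - ?x) \<le> r / 2" using F by simp
        obtain k0 where "\<forall>k\<ge>k0. \<exists>p. ?x = poly_apply ?T p (shift_vec w k)"
          using finite_support_eq_poly_apply_shift_vec[OF w F(1)] by blast
        then obtain p where p: "?x = poly_apply ?T p (shift_vec w (max k0 \<bar>n\<bar>))"
          using max.cobounded1 by blast
        obtain y q where y: "y \<in> lp_space 1" "lp_norm 1 (y - ?x) < r / 2"
          "lp_norm 1 (poly_apply ?T q y - shift_vec w n) < 1 / real (Suc i)"
          using perturbation_reaches_shift_vec[OF w bw j lim _ p, of n "r / 2" "1 / real (Suc i)"] r
          by auto
        have "lp_norm 1 (x - y) < r"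
          using l1.triangle[OF x x' y(1)] xx' y(2) lp_norm_1_minus_commute[of y ?x] by linarith
        then show ?thesis using x y by (auto simp: G_def)
      qed
      then show ?thesis by (auto simp: l1.metric_closure_of)
    qed
  qed
  have "l1.mtopology closure_of \<Inter>(range G) = lp_space 1"
    using G by (intro l1.metric_Baire_category mcomplete_lp_space_1) auto
  moreover have "lp_space 1 \<noteq> {}" using shift_vec_mem by blast
  ultimately obtain x where x: "\<And>n i. x \<in> G (n, i)"
    by (metis (no_types, lifting) INT_iff UNIV_I closure_of_empty equals0I)
  have "\<exists>q. lp_norm 1 (poly_apply ?T q x - shift_vec w n) < e" if e: "e > 0" for n e
  proof -
    obtain i where "1 / real (Suc i) < e" using e by (metis nat_approx_posE)
    then show ?thesis using x[of n i] by (auto simp: G_def intro: less_trans)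
  qed
  moreover have "x \<in> lp_space 1" using x[of 0 0] by (simp add: G_def)
  ultimately show ?thesis by blast
qed

text \<open>
  A finitely supported vector is \<open>p(T) f\<^sub>k\<close>, so approximating the single vector \<open>f\<^sub>k\<close> by \<open>q(T) x\<close> is
  enough: apply \<open>p(T)\<close> to both.
\<close>

lemma finite_support_approximation:
  assumes w: "\<forall>n. w n \<noteq> 0" and F: "finite F" and e: "e > 0"
    and bT: "bounded_operator (lp_space 1) (lp_norm 1) (bilateral_shift w)"
    and x: "x \<in> lp_space 1"
    and appr: "\<And>n e. e > 0 \<Longrightarrow> \<exists>q. lp_norm 1 (poly_apply (bilateral_shift w) q x - shift_vec w n) < e"
  shows "\<exists>q. lp_norm 1 ((\<lambda>n. if n \<in> F then y n else 0) - poly_apply (bilateral_shift w) q x) < e"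
proof -
  let ?T = "bilateral_shift w" and ?y = "\<lambda>n. if n \<in> F then y n else 0"
  note T = module_hom_bilateral_shift[of w]
  obtain k p where p: "?y = poly_apply ?T p (shift_vec w k)"
    using finite_support_eq_poly_apply_shift_vec[OF w F] by blast
  obtain K where K: "K > 0" "\<And>x. x \<in> lp_space 1 \<Longrightarrow> lp_norm 1 (poly_apply ?T p x) \<le> K * lp_norm 1 x"
    using poly_apply_bounded[OF T bT] by blast
  obtain q where q: "lp_norm 1 (poly_apply ?T q x - shift_vec w k) < e / K"
    using appr[of "e / K"] e K by auto
  have "poly_apply ?T q x \<in> lp_space 1" using poly_apply_bounded[OF T bT, of q] x by blast
  then have "shift_vec w k - poly_apply ?T q x \<in> lp_space 1" by (simp add: lp_space_diff shift_vec_mem)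
  then have "lp_norm 1 (?y - poly_apply ?T (p * q) x) \<le> K * lp_norm 1 (shift_vec w k - poly_apply ?T q x)"
    using K(2) by (simp add: p poly_apply_mult[OF T] flip: poly_apply_diff[OF T])
  also have "\<dots> < K * (e / K)"
    using q K(1) unfolding lp_norm_1_minus_commute[of "shift_vec w k"]
    by (intro mult_strict_left_mono)
  finally show ?thesis using K by auto
qed

theorem corollary1p6:
  fixes w :: "int \<Rightarrow> complex"
  assumes "bounded (range w)"
    and "\<forall>n. w n \<noteq> 0"
    and "\<exists>j::nat. j > 0 \<and>
           (\<forall>a::nat. a > 0 \<longrightarrow>
              liminf (\<lambda>m. ereal (wtilde w (int a - int j * int m) 0 / wtilde w 1 (int m) ^ j)) = 0)"
  shows "\<forall>p::ereal. 1 \<le> p \<longrightarrow> cyclic_operator (lp_space p) (lp_norm p) (bilateral_shift w)"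
proof (intro allI impI)
  fix p :: ereal assume p: "1 \<le> p"
  let ?T = "bilateral_shift w"
  note T = module_hom_bilateral_shift[of w]
  have bT: "bounded_operator (lp_space 1) (lp_norm 1) ?T"
    using bounded_operator_bilateral_shift[OF assms(1)] by simp
  obtain j :: nat where j: "j > 0" and lim: "\<And>a::nat. a > 0 \<Longrightarrow>
      liminf (\<lambda>m. ereal (wtilde w (int a - int j * int m) 0 / wtilde w 1 (int m) ^ j)) = 0"
    using assms(3) by blast
  obtain x where x: "x \<in> lp_space 1"
    "\<And>n e. e > 0 \<Longrightarrow> \<exists>q. lp_norm 1 (poly_apply ?T q x - shift_vec w n) < e"
    using exists_vector_approximating_shift_vecs[OF assms(2,1) j lim] by blast
  have "\<exists>z\<in>module.span cscale (range (\<lambda>n. (?T ^^ n) x)). lp_norm p (y - z) < e"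
    if y: "y \<in> lp_space p" and e: "e > 0" for y e
  proof -
    obtain F where F: "finite F" "lp_norm p (\<lambda>n. if n \<in> F then 0 else y n) \<le> e / 8"
      using lp_norm_truncation[OF p y, of "e / 8"] e by auto
    let ?y = "\<lambda>n. if n \<in> F then y n else 0" and ?r = "\<lambda>n. if n \<in> F then 0 else y n"
    obtain q where q: "lp_norm 1 (?y - poly_apply ?T q x) < e / 8"
      using finite_support_approximation[OF assms(2) F(1) _ bT x, of "e / 8" y] e by auto
    have r: "?r \<in> lp_space p" by (rule lp_space_dominated[OF p y]) auto
    obtain k u where "?y = poly_apply ?T u (shift_vec w k)"
      using finite_support_eq_poly_apply_shift_vec[OF assms(2) F(1)] by blast
    then have "?y \<in> lp_space 1"
      using poly_apply_bounded[OF T bT, of u] shift_vec_mem by auto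
    moreover have "poly_apply ?T q x \<in> lp_space 1"
      using poly_apply_bounded[OF T bT, of q] x(1) by blast
    ultimately have d: "?y - poly_apply ?T q x \<in> lp_space 1"
      by (rule lp_space_diff[OF order.refl])
    note dp = lp_space_1_subset_and_norm_le[OF p d]
    have split: "y - poly_apply ?T q x = ?r + (?y - poly_apply ?T q x)" by (auto simp: fun_eq_iff)
    have "lp_norm p (y - poly_apply ?T q x)
        \<le> 4 * max (lp_norm p ?r) (lp_norm p (?y - poly_apply ?T q x))"
      unfolding split using lp_norm_add_le[OF p r] dp by blast
    also have "\<dots> < e" using F(2) q dp e by auto
    finally show ?thesis using poly_apply_mem_span by blast
  qed
  moreover have "x \<in> lp_space p" using lp_space_1_subset_and_norm_le[OF p x(1)] by blast
  ultimately show "cyclic_operator (lp_space p) (lp_norm p) ?T"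
    unfolding cyclic_operator_def by blast
qed

end
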